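(* (Cauchy identity.) In $\mathbb{A}\otimes_{\mathbb{Z}}\mathbb{A}$ one has $$\sum_\lambda U_\lambda\otimes U_\lambda=\sum_\lambda t_\lambda\otimes u_\lambda,$$ where the sums either run over all partitions $\lambda$ of a fixed (arbitrary) integer $n\ge 0$, or are regarded as formal sums over all partitions.
   Context: An integer sequence (integer vector) is a sequence $\alpha=(\alpha_1,\alpha_2,\ldots)$ of integers with only finitely many nonzero terms; it is a partition if $\alpha_i\ge\alpha_{i+1}\ge 0$ for all $i$, and a partition of $n$ if moreover $\sum_i\alpha_i=n$. Let $\mathbb{A}=\mathbb{Z}[u_1,u_2,\ldots]$ be the polynomial ring in countably many independent variables, with $u_0=1$ and $u_r=0$ for $r<0$. For an integer vector $\alpha$ put $u_\alpha=\prod_i u_{\alpha_i}$. For $i<j$ let $R_{ij}(\alpha)=(\alpha_1,\ldots,\alpha_i+1,\ldots,\alpha_j-1,\ldots)$; a raising operator $R$ is a monomial in the $R_{ij}$, and $R\,u_\alpha:=u_{R\alpha}$ (the operator acts on the index $\alpha$). The Schur polynomial of an integer vector $\alpha$ is $$U_\alpha:=\prod_{i<j}(1-R_{ij})\,u_\alpha\in\mathbb{A};$$ after formal expansion only finitely many summands are nonzero. The $U_\lambda$ for $\lambda$ a partition form a $\mathbb{Z}$-basis of $\mathbb{A}$. The Kostka numbers $K_{\lambda,\mu}$ ($\lambda,\mu$ partitions) are defined by $u_\mu=\sum_\lambda K_{\lambda,\mu}U_\lambda$; $K_{\lambda,\mu}$ is the number of semistandard Young tableaux of shape $\lambda$ and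 content $\mu$. The matrix $K=\{K_{\lambda,\mu}\}$ is lower unitriangular with respect to dominance order, so the equations $$U_\lambda=\sum_\mu K_{\lambda,\mu}\,t_\mu\qquad(\lambda\text{ a partition})$$ (sum over partitions $\mu$) define a $\mathbb{Z}$-basis $\{t_\lambda\}$ of $\mathbb{A}$ indexed by partitions. *)

theory Defs
  imports Main "HOL-Library.Poly_Mapping"
begin

section \<open>The tensor product of abelian groups over the integers\<close>

text \<open>
  \<^typ>\<open>'a \<times> 'b \<Rightarrow>\<^sub>0 int\<close> is the free abelian group on \<^typ>\<open>'a \<times> 'b\<close>; the tensor product is its
  quotient by the subgroup generated by the bilinearity relations.  Over the integers
  biadditivity already implies bilinearity for scalars.
\<close>

inductive_set tensor_rel :: "(('a::ab_group_add \<times> 'b::ab_group_add) \<Rightarrow>\<^sub>0 int) set" where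
  left: "frag_of (a + a', b) - frag_of (a, b) - frag_of (a', b) \<in> tensor_rel"
| right: "frag_of (a, b + b') - frag_of (a, b) - frag_of (a, b') \<in> tensor_rel"
| zero: "0 \<in> tensor_rel"
| diff: "x \<in> tensor_rel \<Longrightarrow> y \<in> tensor_rel \<Longrightarrow> x - y \<in> tensor_rel"

lemma tensor_rel_uminus: "x \<in> tensor_rel \<Longrightarrow> - x \<in> tensor_rel"
  using tensor_rel.diff[OF tensor_rel.zero] by fastforce

lemma tensor_rel_add: "x \<in> tensor_rel \<Longrightarrow> y \<in> tensor_rel \<Longrightarrow> x + y \<in> tensor_rel"
  using tensor_rel.diff[OF _ tensor_rel_uminus] by fastforce

definition tensor_eq ::
  "(('a::ab_group_add \<times> 'b::ab_group_add) \<Rightarrow>\<^sub>0 int) \<Rightarrow> ('a \<times> 'b \<Rightarrow>\<^sub>0 int) \<Rightarrow> bool" where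
  "tensor_eq x y \<longleftrightarrow> x - y \<in> tensor_rel"

lemma equivp_tensor_eq: "equivp tensor_eq"
proof (rule equivpI)
  show "reflp tensor_eq"
    by (simp add: reflp_def tensor_eq_def tensor_rel.zero)
  show "symp tensor_eq"
    unfolding symp_def tensor_eq_def using tensor_rel_uminus by fastforce
  show "transp tensor_eq"
    unfolding transp_def tensor_eq_def using tensor_rel_add by fastforce
qed

quotient_type (overloaded) ('a, 'b) tensor =
  "('a::ab_group_add \<times> 'b::ab_group_add) \<Rightarrow>\<^sub>0 int" / tensor_eq
  by (rule equivp_tensor_eq)

instantiation tensor :: (ab_group_add, ab_group_add) ab_group_add
begin

lift_definition zero_tensor :: "('a, 'b) tensor" is 0 .

lift_definition plus_tensor :: "('a, 'b) tensor \<Rightarrow> ('a, 'b) tensor \<Rightarrow> ('a, 'b) tensor" is "(+)"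
  unfolding tensor_eq_def using tensor_rel_add by (fastforce simp: algebra_simps)

lift_definition uminus_tensor :: "('a, 'b) tensor \<Rightarrow> ('a, 'b) tensor" is uminus
  unfolding tensor_eq_def using tensor_rel_uminus by fastforce

definition minus_tensor :: "('a, 'b) tensor \<Rightarrow> ('a, 'b) tensor \<Rightarrow> ('a, 'b) tensor" where
  "minus_tensor x y = x + - y"

instance
proof
  fix a b c :: "('a, 'b) tensor"
  show "a + b + c = a + (b + c)"
    by transfer (simp add: tensor_eq_def tensor_rel.zero add.assoc)
  show "a + b = b + a"
    by transfer (simp add: tensor_eq_def tensor_rel.zero add.commute)
  show "0 + a = a"
    by transfer (simp add: tensor_eq_def tensor_rel.zero)
  show "- a + a = 0"
    by transfer (simp add: tensor_eq_def tensor_rel.zero)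
  show "a - b = a + - b"
    by (rule minus_tensor_def)
qed

end

lift_definition tensor_prod ::
  "'a::ab_group_add \<Rightarrow> 'b::ab_group_add \<Rightarrow> ('a, 'b) tensor" (infixl "\<otimes>\<^sub>Z" 70)
  is "\<lambda>a b. frag_of (a, b)" .

section \<open>Integer vectors, partitions and raising operators\<close>

text \<open>Positions are counted from 0, i.e. \<^term>\<open>Poly_Mapping.lookup \<alpha> i\<close> is the entry $\alpha_{i+1}$.\<close>

type_synonym intvec = "nat \<Rightarrow>\<^sub>0 int"

definition is_partition :: "intvec \<Rightarrow> bool" where
  "is_partition \<alpha> \<longleftrightarrow> (\<forall>i. Poly_Mapping.lookup \<alpha> i \<ge> Poly_Mapping.lookup \<alpha> (Suc i) \<and> Poly_Mapping.lookup \<alpha> (Suc i) \<ge> 0)"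

definition partitions :: "intvec set" where
  "partitions = {\<alpha>. is_partition \<alpha>}"

definition partitions_of :: "nat \<Rightarrow> intvec set" where
  "partitions_of n = {\<alpha>. is_partition \<alpha> \<and> (\<Sum>i\<in>Poly_Mapping.keys \<alpha>. Poly_Mapping.lookup \<alpha> i) = int n}"

definition raising :: "nat \<times> nat \<Rightarrow> intvec \<Rightarrow> intvec" where
  "raising p \<alpha> = \<alpha> + Poly_Mapping.single (fst p) 1 - Poly_Mapping.single (snd p) 1"

text \<open>The squarefree monomial $\prod_{(i,j) \in S} R_{ij}$; the factors commute.\<close>

definition raising_prod :: "(nat \<times> nat) set \<Rightarrow> intvec \<Rightarrow> intvec" where
  "raising_prod S \<alpha> = Finite_Set.fold raising \<alpha> S"

section \<open>The ring $\mathbb{A}$ and its bases\<close>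

text \<open>
  Integer polynomials in countably many variables $x_0, x_1, \ldots$, with $u_r = x_{r-1}$ for
  $r \geq 1$.
\<close>

type_synonym upoly = "(nat \<Rightarrow>\<^sub>0 nat) \<Rightarrow>\<^sub>0 int"

definition u_gen :: "int \<Rightarrow> upoly" where
  "u_gen r = (if r < 0 then 0 else if r = 0 then 1
     else Poly_Mapping.single (Poly_Mapping.single (nat r - 1) 1) 1)"

definition u_vec :: "intvec \<Rightarrow> upoly" where
  "u_vec \<alpha> = (\<Prod>i\<in>Poly_Mapping.keys \<alpha>. u_gen (Poly_Mapping.lookup \<alpha> i))"

text \<open>
  Formal expansion of $\prod_{i<j} (1 - R_{ij})$: a summand arises by choosing $-R_{ij}$ for the
  pairs in a finite set \<^term>\<open>S\<close> and 1 for all others.  Only finitely many summands are nonzero,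
  since \<^term>\<open>u_vec\<close> vanishes on vectors with a negative entry.
\<close>

definition schur :: "intvec \<Rightarrow> upoly" where
  "schur \<alpha> =
    (\<Sum>S | finite S \<and> S \<subseteq> {(i, j). i < j} \<and> u_vec (raising_prod S \<alpha>) \<noteq> 0.
       (- 1) ^ card S * u_vec (raising_prod S \<alpha>))"

text \<open>The coefficients of $u_\mu$ in the basis of the $U_\nu$, $\nu$ a partition.\<close>

definition kostka :: "intvec \<Rightarrow> intvec \<Rightarrow> int" where
  "kostka \<kappa> \<mu> =
    Poly_Mapping.lookup (THE c :: intvec \<Rightarrow>\<^sub>0 int. Poly_Mapping.keys c \<subseteq> partitions \<and>
       u_vec \<mu> = (\<Sum>\<nu>\<in>Poly_Mapping.keys c. of_int (Poly_Mapping.lookup c \<nu>) * schur \<nu>)) \<kappa>"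

text \<open>
  The solution of $U_\kappa = \sum_\mu K_{\kappa,\mu} t_\mu$.  Each of these sums is finite;
  it is written over the support because an infinite index set would make it 0.  The value 0
  outside the partitions is irrelevant, it only makes the solution unique as a total function.
\<close>

definition t_poly :: "intvec \<Rightarrow> upoly" where
  "t_poly = (THE t.
     (\<forall>\<mu>. \<not> is_partition \<mu> \<longrightarrow> t \<mu> = 0) \<and>
     (\<forall>\<kappa>. is_partition \<kappa> \<longrightarrow>
        schur \<kappa> =
          (\<Sum>\<mu> | is_partition \<mu> \<and> kostka \<kappa> \<mu> \<noteq> 0. of_int (kostka \<kappa> \<mu>) * t \<mu>)))"

section \<open>Formal sums\<close>

text \<open>
  $\mathbb{A}$ is graded by $\deg u_r = r$.  A formal sum in $\mathbb{A} \otimes \mathbb{A}$ is an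
  element of the completion $\prod_{m,n} \mathbb{A}_m \otimes \mathbb{A}_n$, given by its bihomogeneous
  components; it makes sense if every component receives only finitely many nonzero contributions.
\<close>

definition wdeg :: "(nat \<Rightarrow>\<^sub>0 nat) \<Rightarrow> nat" where
  "wdeg m = (\<Sum>i\<in>Poly_Mapping.keys m. Suc i * Poly_Mapping.lookup m i)"

definition hom_comp :: "nat \<Rightarrow> upoly \<Rightarrow> upoly" where
  "hom_comp d = frag_extend (\<lambda>m. if wdeg m = d then frag_of m else 0)"

lemma hom_comp_add: "hom_comp d (p + q) = hom_comp d p + hom_comp d q"
  by (simp add: hom_comp_def frag_extend_add)

lift_definition bihom_comp :: "nat \<Rightarrow> nat \<Rightarrow> (upoly, upoly) tensor \<Rightarrow> (upoly, upoly) tensor"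
  is "\<lambda>m n. frag_extend (\<lambda>(a, b). frag_of (hom_comp m a, hom_comp n b))"
proof -
  fix m n :: nat and x y :: "upoly \<times> upoly \<Rightarrow>\<^sub>0 int"
  let ?f = "frag_extend (\<lambda>(a, b). frag_of (hom_comp m a, hom_comp n b))"
  have "?f z \<in> tensor_rel" if "z \<in> tensor_rel" for z
    using that
  proof induction
    case (left a a' b)
    show ?case
      by (simp add: frag_extend_diff hom_comp_add tensor_rel.left)
  next
    case (right a b b')
    show ?case
      by (simp add: frag_extend_diff hom_comp_add tensor_rel.right)
  next
    case zero
    show ?case
      by (simp add: tensor_rel.zero)
  next
    case (diff x y)
    then show ?case
      by (simp add: frag_extend_diff tensor_rel.diff)
  qed
  then show "tensor_eq x y \<Longrightarrow> tensor_eq (?f x) (?f y)"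
    by (simp add: tensor_eq_def flip: frag_extend_diff)
qed

definition formally_summable :: "'i set \<Rightarrow> ('i \<Rightarrow> (upoly, upoly) tensor) \<Rightarrow> bool" where
  "formally_summable I x \<longleftrightarrow> (\<forall>m n. finite {i \<in> I. bihom_comp m n (x i) \<noteq> 0})"

definition formal_sum ::
  "'i set \<Rightarrow> ('i \<Rightarrow> (upoly, upoly) tensor) \<Rightarrow> nat \<Rightarrow> nat \<Rightarrow> (upoly, upoly) tensor" where
  "formal_sum I x m n = (\<Sum>i | i \<in> I \<and> bihom_comp m n (x i) \<noteq> 0. bihom_comp m n (x i))"

end

theory Submission
  imports Defs "HOL-Library.Multiset"
begin

text \<open>
  In each degree $n$ both the products $u_\nu$ and the Schur polynomials $U_\kappa$ are bases, so
  there are integers $a_{\kappa\nu}$ with $U_\kappa = \sum_\nu a_{\kappa\nu} u_\nu$, and the matrix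
  $a$ is inverse to the Kostka matrix, up to transposition.  The equations defining the $t_\nu$ are
  thereby solved explicitly: $t_\nu = \sum_\kappa a_{\kappa\nu} U_\kappa$ (\<open>t_poly_eq\<close>).  Hence both
  sides of the Cauchy identity equal $\sum_{\kappa,\nu} a_{\kappa\nu}\, U_\kappa \otimes u_\nu$, once
  summed over $\nu$ first and once over $\kappa$ first (\<open>cauchy_homogeneous\<close>).
  
  The $u_\nu$ form a basis because sending a partition to its multiset of nonzero parts is a bijection
  onto the monomials in the variables (\<open>mon_inj\<close>, \<open>mon_surj\<close>).  The $U_\kappa$ form a
  basis because they are unitriangular in the $u_\nu$.  The order used here is not dominance but
  the sum of the squares of the parts: raising operators transfer units from later, smaller entries to
  earlier, larger ones and so increase the sum of squares strictly
  (\<open>raising_prod_statistics\<close>), and this sum, unlike dominance, can be read off from the monomial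
  without sorting the raised vector (\<open>keys_schur_minus_leading\<close>).  Linear independence and
  spanning follow by looking at the least sum of squares and by induction on it (\<open>schur_independent\<close>,
  \<open>schur_span\<close>).
  
  For the formal sums, $U_\kappa$ and $t_\kappa$ are homogeneous of degree $|\kappa|$, so the
  component of bidegree $(m, n)$ only receives contributions from the finitely many partitions of $m$
  and is a component of the identity in degree $m$.
\<close>

abbreviation lookup where "lookup \<equiv> Poly_Mapping.lookup"
abbreviation keys where "keys \<equiv> Poly_Mapping.keys"
abbreviation single where "single \<equiv> Poly_Mapping.single"

section \<open>Partitions and monomials\<close>

text \<open>
  Additive statistics of monomials: degrees, sums of squares and numbers of large parts are all of this
  form, which is how they are compared with the entries of an integer vector.
\<close>

definition weight :: "(nat \<Rightarrow> nat) \<Rightarrow> (nat \<Rightarrow>\<^sub>0 nat) \<Rightarrow> nat" where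
  "weight w m = (\<Sum>k\<in>keys m. w k * lookup m k)"

lemma weight_zero [simp]: "weight w 0 = 0"
  by (simp add: weight_def)

lemma weight_add: "weight w (m + m') = weight w m + weight w m'"
  unfolding weight_def
  by (rule setsum_keys_plus_distrib) (simp_all add: algebra_simps)

lemma weight_sum: "weight w (sum f I) = (\<Sum>i\<in>I. weight w (f i))"
  by (induction I rule: infinite_finite_induct) (simp_all add: weight_add)

lemma wdeg_eq_weight: "wdeg m = weight Suc m"
  by (simp add: wdeg_def weight_def)

definition sqdeg :: "(nat \<Rightarrow>\<^sub>0 nat) \<Rightarrow> nat" where
  "sqdeg = weight (\<lambda>k. (Suc k)\<^sup>2)"

definition u_exp :: "int \<Rightarrow> (nat \<Rightarrow>\<^sub>0 nat)" where
  "u_exp r = (if r \<le> 0 then 0 else single (nat r - 1) 1)"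

text \<open>
  The exponent vector of $u_\alpha$ for $\alpha$ without negative entries.
\<close>

definition mon :: "intvec \<Rightarrow> (nat \<Rightarrow>\<^sub>0 nat)" where
  "mon \<alpha> = (\<Sum>i\<in>keys \<alpha>. u_exp (lookup \<alpha> i))"

lemma weight_mon:
  "weight w (mon \<alpha>) = (\<Sum>i\<in>keys \<alpha>. if lookup \<alpha> i \<le> 0 then 0 else w (nat (lookup \<alpha> i) - 1))"
  unfolding mon_def weight_sum by (rule sum.cong) (auto simp: u_exp_def weight_def)

lemma weight_mon_nonneg:
  assumes "\<And>i. lookup \<alpha> i \<ge> 0" "f 0 = 0" "\<And>k. f (int (Suc k)) = int (w k)"
  shows "int (weight w (mon \<alpha>)) = (\<Sum>i\<in>keys \<alpha>. f (lookup \<alpha> i))"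
  unfolding weight_mon of_nat_sum
proof (rule sum.cong)
  fix i
  show "int (if lookup \<alpha> i \<le> 0 then 0 else w (nat (lookup \<alpha> i) - 1)) = f (lookup \<alpha> i)"
    using assms(1)[of i] assms(2) assms(3)[of "nat (lookup \<alpha> i) - 1"]
    by (cases "lookup \<alpha> i = 0") simp_all
qed simp

lemma int_wdeg_mon:
  assumes "\<And>i. lookup \<alpha> i \<ge> 0"
  shows "int (wdeg (mon \<alpha>)) = (\<Sum>i\<in>keys \<alpha>. lookup \<alpha> i)"
  unfolding wdeg_eq_weight by (rule weight_mon_nonneg) (simp_all add: assms)

lemma int_sqdeg_mon:
  assumes "\<And>i. lookup \<alpha> i \<ge> 0"
  shows "int (sqdeg (mon \<alpha>)) = (\<Sum>i\<in>keys \<alpha>. (lookup \<alpha> i)\<^sup>2)"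
  unfolding sqdeg_def by (rule weight_mon_nonneg) (simp_all add: assms)

lemma u_vec_nonneg:
  assumes "\<And>i. lookup \<alpha> i \<ge> 0"
  shows "u_vec \<alpha> = frag_of (mon \<alpha>)"
proof -
  have "(\<Prod>i\<in>I. u_gen (lookup \<alpha> i)) = frag_of (\<Sum>i\<in>I. u_exp (lookup \<alpha> i))" if "finite I" for I
    using that
  proof (induction I)
    case (insert i I)
    have "u_gen (lookup \<alpha> i) = frag_of (u_exp (lookup \<alpha> i))"
      using assms[of i] by (auto simp: u_gen_def u_exp_def)
    with insert show ?case by (simp add: mult_single)
  qed simp
  then show ?thesis by (simp add: u_vec_def mon_def)
qed

lemma u_vec_neg: "lookup \<alpha> i < 0 \<Longrightarrow> u_vec \<alpha> = 0"
  unfolding u_vec_def by (rule prod_zero) (auto simp: u_gen_def in_keys_iff intro!: bexI[of _ i])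

lemma partition_antimono:
  assumes "is_partition \<nu>" "i \<le> j"
  shows "lookup \<nu> j \<le> lookup \<nu> i"
  using assms(2) by (induction rule: dec_induct) (use assms(1) in \<open>auto simp: is_partition_def intro: order_trans\<close>)

lemma partition_nonneg:
  assumes "is_partition \<nu>"
  shows "lookup \<nu> i \<ge> 0"
  using assms unfolding is_partition_def by (meson order_trans)

lemma u_vec_partition: "is_partition \<nu> \<Longrightarrow> u_vec \<nu> = frag_of (mon \<nu>)"
  by (simp add: u_vec_nonneg partition_nonneg)

lemma partitions_of_eq: "partitions_of n = {\<nu>. is_partition \<nu> \<and> wdeg (mon \<nu>) = n}"
  unfolding partitions_of_def by (auto simp flip: int_wdeg_mon simp: partition_nonneg)

text \<open>
  The weight here counts the parts of size at least $v$; these form an initial segment of the positions.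
  In other words the monomial determines the conjugate partition and hence the partition.
\<close>

lemma partition_entry_ge_iff:
  assumes "is_partition \<nu>" "v \<ge> 1"
  shows "lookup \<nu> i \<ge> int v \<longleftrightarrow> i < weight (\<lambda>k. if Suc k \<ge> v then 1 else 0) (mon \<nu>)"
proof -
  let ?J = "{j. lookup \<nu> j \<ge> int v}"
  have fin: "?J \<subseteq> keys \<nu>" using assms(2) by (auto simp: in_keys_iff)
  have fin': "finite ?J" by (rule finite_subset[OF fin finite_keys])
  have "weight (\<lambda>k. if Suc k \<ge> v then 1 else 0) (mon \<nu>) = (\<Sum>j\<in>keys \<nu>. if j \<in> ?J then 1 else 0)"
    unfolding weight_mon by (rule sum.cong) (use assms(2) in auto)
  also have "\<dots> = card (keys \<nu> \<inter> ?J)" by (simp add: sum.If_cases)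
  also have "keys \<nu> \<inter> ?J = ?J" using fin by blast
  finally have w: "weight (\<lambda>k. if Suc k \<ge> v then 1 else 0) (mon \<nu>) = card ?J" .
  have down: "j \<in> ?J" if "i \<in> ?J" "j \<le> i" for i j
    using that partition_antimono[OF assms(1), of j i] by auto
  show ?thesis
  proof
    assume "lookup \<nu> i \<ge> int v"
    then have "{..i} \<subseteq> ?J" using down by blast
    then have "card {..i} \<le> card ?J" using fin' card_mono by blast
    then show "i < weight (\<lambda>k. if Suc k \<ge> v then 1 else 0) (mon \<nu>)" by (simp add: w)
  next
    assume *: "i < weight (\<lambda>k. if Suc k \<ge> v then 1 else 0) (mon \<nu>)"
    show "lookup \<nu> i \<ge> int v"
    proof (rule ccontr)
      assume "\<not> lookup \<nu> i \<ge> int v"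
      then have "?J \<subseteq> {..<i}" using down[of _ i] by (auto simp: not_le[symmetric])
      then have "card ?J \<le> i" using card_mono[of "{..<i}" ?J] by simp
      with * w show False by simp
    qed
  qed
qed

lemma mon_inj:
  assumes "is_partition \<mu>" "is_partition \<nu>" "mon \<mu> = mon \<nu>"
  shows "\<mu> = \<nu>"
proof (rule poly_mapping_eqI)
  fix i
  have *: "lookup \<mu> i \<ge> int v \<longleftrightarrow> lookup \<nu> i \<ge> int v" for v
    using assms partition_nonneg[of \<mu> i] partition_nonneg[of \<nu> i]
    by (cases "v = 0") (auto simp: partition_entry_ge_iff)
  show "lookup \<mu> i = lookup \<nu> i"
    using *[of "nat (lookup \<mu> i)"] *[of "nat (lookup \<nu> i)"] assms partition_nonneg[of \<mu> i] partition_nonneg[of \<nu> i]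
    by simp
qed

text \<open>
  The right-hand side does not depend on the order of the list, so sorting a list of parts into a
  partition does not change the monomial.
\<close>

lemma mon_nth: "mon (Poly_Mapping.nth xs) = (\<Sum>r\<leftarrow>xs. u_exp r)"
proof -
  let ?f = "\<lambda>i. u_exp (nth_default 0 xs i)"
  have "mon (Poly_Mapping.nth xs) = (\<Sum>i<length xs. ?f i)"
    unfolding mon_def
    by (rule sum.mono_neutral_cong_left)
       (auto simp: in_keys_iff nth_default_def u_exp_def simp del: keys_nth split: if_splits)
  also have "\<dots> = (\<Sum>r\<leftarrow>xs. u_exp r)"
    by (simp add: sum_list_sum_nth nth_default_def atLeast0LessThan)
  finally show ?thesis .
qed

lemma sum_single_lookup: "(\<Sum>k\<in>keys m. single k (lookup m k)) = m"
  by (rule poly_mapping_eqI) (simp add: lookup_sum lookup_single when_def in_keys_iff)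

lemma ex_list_mon: "\<exists>xs. (\<forall>r\<in>set xs. r \<ge> 0) \<and> (\<Sum>r\<leftarrow>xs. u_exp r) = m"
proof -
  have "\<exists>xs. (\<forall>r\<in>set xs. r \<ge> 0) \<and> (\<Sum>r\<leftarrow>xs. u_exp r) = (\<Sum>k\<in>K. single k (lookup m k))" if "finite K" for K
    using that
  proof (induction K)
    case empty
    then show ?case by (intro exI[of _ "[]"]) simp
  next
    case (insert k K)
    then obtain xs where xs: "\<forall>r\<in>set xs. r \<ge> 0" "(\<Sum>r\<leftarrow>xs. u_exp r) = (\<Sum>k\<in>K. single k (lookup m k))"
      by blast
    have "(\<Sum>r\<leftarrow>replicate n (int k + 1). u_exp r) = single k n" for n
      by (induction n) (simp_all add: u_exp_def nat_add_distrib flip: single_add)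
    with xs insert show ?case
      by (intro exI[of _ "replicate (lookup m k) (int k + 1) @ xs"]) auto
  qed
  from this[of "keys m"] show ?thesis
    using sum_single_lookup[of m] by simp
qed

lemma mon_surj: "\<exists>\<nu>. is_partition \<nu> \<and> mon \<nu> = m"
proof -
  obtain xs where xs: "\<forall>r\<in>set xs. r \<ge> 0" "(\<Sum>r\<leftarrow>xs. u_exp r) = m"
    using ex_list_mon by blast
  let ?ys = "rev (sort xs)"
  have "mset (map u_exp ?ys) = mset (map u_exp xs)" by (simp only: mset_map mset_rev mset_sort)
  then have "(\<Sum>r\<leftarrow>?ys. u_exp r) = m"
    using xs(2) by (metis sum_mset_sum_list)
  moreover have "is_partition (Poly_Mapping.nth ?ys)"
    unfolding is_partition_def
  proof (intro allI conjI)
    fix i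
    have nonneg: "nth_default 0 ?ys j \<ge> 0" for j
      using xs(1) nth_mem[of j ?ys] by (auto simp: nth_default_def simp del: nth_mem)
    then show "lookup (Poly_Mapping.nth ?ys) (Suc i) \<ge> 0" by simp
    have "sorted_wrt (\<ge>) ?ys" by (simp add: sorted_wrt_rev)
    then show "lookup (Poly_Mapping.nth ?ys) (Suc i) \<le> lookup (Poly_Mapping.nth ?ys) i"
      using nonneg[of i] sorted_wrt_nth_less[of "(\<ge>)" ?ys i "Suc i"] by (auto simp: nth_default_def)
  qed
  ultimately show ?thesis by (auto simp: mon_nth)
qed

section \<open>Raising operators and leading terms\<close>

lemma raising_prod_eq:
  assumes "finite S"
  shows "raising_prod S \<alpha> = \<alpha> + (\<Sum>p\<in>S. single (fst p) 1 - single (snd p) 1)"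
proof -
  interpret comp_fun_commute raising
    by standard (simp add: fun_eq_iff raising_def algebra_simps)
  from assms show ?thesis
    unfolding raising_prod_def
    by (induction S) (simp_all, simp add: raising_def algebra_simps)
qed

lemma lookup_raising_prod:
  assumes "finite S"
  shows "lookup (raising_prod S \<alpha>) i =
    lookup \<alpha> i + (\<Sum>p\<in>S. of_bool (fst p = i) - of_bool (snd p = i))"
  by (auto simp: raising_prod_eq[OF assms] lookup_add lookup_sum lookup_minus lookup_single when_def
      intro!: sum.cong)

text \<open>
  If $j$ is the largest position touched by $S$, every factor touching $j$ decreases the entry there; an
  entry that was 0 becomes negative, which kills $u$.  This makes the expansion of
  $\prod_{i<j}(1 - R_{ij}) u_\alpha$ finite.
\<close>

lemma raising_prod_support:
  assumes "finite S" "S \<subseteq> {(i, j). i < j}" "keys \<alpha> \<subseteq> {..<L}" "u_vec (raising_prod S \<alpha>) \<noteq> 0"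
  shows "S \<subseteq> {..<L} \<times> {..<L}"
proof (cases "S = {}")
  case False
  define j where "j = Max (snd ` S)"
  have le_j: "snd p \<le> j" if "p \<in> S" for p
    using that assms(1) by (simp add: j_def)
  have "j < L"
  proof (rule ccontr)
    assume "\<not> j < L"
    then have "lookup \<alpha> j = 0" using assms(3) by (auto simp: in_keys_iff)
    moreover have "j \<in> snd ` S"
      unfolding j_def using assms(1) False by (intro Max_in) auto
    then obtain p where p: "p \<in> S" "snd p = j" by (rule imageE) simp
    moreover have "(\<Sum>p\<in>S. of_bool (fst p = j) - of_bool (snd p = j) :: int) < (\<Sum>p\<in>S. 0)"
    proof (rule sum_strict_mono_ex1)
      have "fst p \<noteq> j" if "p \<in> S" for p
        using le_j[OF that] that assms(2) by auto
      then show "\<forall>p\<in>S. of_bool (fst p = j) - of_bool (snd p = j) \<le> (0 :: int)"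
        "\<exists>p\<in>S. of_bool (fst p = j) - of_bool (snd p = j) < (0 :: int)"
        using p by auto
    qed fact
    ultimately have "lookup (raising_prod S \<alpha>) j < 0"
      by (simp add: lookup_raising_prod[OF assms(1)])
    with u_vec_neg assms(4) show False by blast
  qed
  show ?thesis
  proof
    fix p assume "p \<in> S"
    with le_j[of p] \<open>j < L\<close> assms(2) show "p \<in> {..<L} \<times> {..<L}" by (cases p) auto
  qed
qed simp

lemma finite_schur_index:
  "finite {S. finite S \<and> S \<subseteq> {(i, j). i < j} \<and> u_vec (raising_prod S \<alpha>) \<noteq> 0}"
proof -
  obtain L where "keys \<alpha> \<subseteq> {..<L}"
    using finite_keys[of \<alpha>] by (auto simp: finite_nat_set_iff_bounded)
  then have "{S. finite S \<and> S \<subseteq> {(i, j). i < j} \<and> u_vec (raising_prod S \<alpha>) \<noteq> 0}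
      \<subseteq> Pow ({..<L} \<times> {..<L})"
    using raising_prod_support by blast
  then show ?thesis by (rule finite_subset) simp
qed

text \<open>
  Let $d = \sum_{(i,j) \in S} (e_i - e_j)$ be the change of the vector.  Then
  $|\kappa + d|^2 = |\kappa|^2 + 2 \langle \kappa, d \rangle + |d|^2$, where
  $\langle \kappa, d \rangle = \sum_{(i,j) \in S} (\kappa_i - \kappa_j) \geq 0$ because $\kappa$ is
  decreasing.
\<close>

lemma raising_prod_statistics:
  assumes "finite S" "S \<subseteq> {(i, j). i < j}" "is_partition \<kappa>"
  shows "(\<Sum>i\<in>keys (raising_prod S \<kappa>). lookup (raising_prod S \<kappa>) i) = (\<Sum>i\<in>keys \<kappa>. lookup \<kappa> i)"
    and "S \<noteq> {} \<Longrightarrow>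
      (\<Sum>i\<in>keys (raising_prod S \<kappa>). (lookup (raising_prod S \<kappa>) i)\<^sup>2) > (\<Sum>i\<in>keys \<kappa>. (lookup \<kappa> i)\<^sup>2)"
proof -
  define \<beta> where "\<beta> = raising_prod S \<kappa>"
  define d where "d i = (\<Sum>p\<in>S. of_bool (fst p = i) - of_bool (snd p = i) :: int)" for i
  define I where "I = keys \<kappa> \<union> keys \<beta> \<union> fst ` S \<union> snd ` S"
  have fin: "finite I" using assms(1) by (simp add: I_def)
  have entry: "lookup \<beta> i = lookup \<kappa> i + d i" for i
    using assms(1) by (simp add: \<beta>_def d_def lookup_raising_prod)
  have to_I: "(\<Sum>i\<in>keys \<gamma>. f (lookup \<gamma> i)) = (\<Sum>i\<in>I. f (lookup \<gamma> i))"
    if "keys \<gamma> \<subseteq> I" "f 0 = 0" for \<gamma> :: intvec and f :: "int \<Rightarrow> int"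
    using that fin by (intro sum.mono_neutral_left) (auto simp: in_keys_iff)
  have subI: "keys \<beta> \<subseteq> I" "keys \<kappa> \<subseteq> I" by (auto simp: I_def)
  have mult_of_bool: "f i * of_bool (a = i) = (if a = i then f i else 0)"
    for f :: "nat \<Rightarrow> int" and a i
    by simp
  have pairing: "(\<Sum>i\<in>I. f i * d i) = (\<Sum>p\<in>S. f (fst p) - f (snd p))" for f :: "nat \<Rightarrow> int"
  proof -
    have "(\<Sum>i\<in>I. f i * d i) = (\<Sum>p\<in>S. \<Sum>i\<in>I. f i * (of_bool (fst p = i) - of_bool (snd p = i)))"
      unfolding d_def sum_distrib_left by (rule sum.swap)
    also have "\<dots> = (\<Sum>p\<in>S. f (fst p) - f (snd p))"
    proof (rule sum.cong)
      fix p assume "p \<in> S"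
      then have "fst p \<in> I" "snd p \<in> I" by (auto simp: I_def)
      then show "(\<Sum>i\<in>I. f i * (of_bool (fst p = i) - of_bool (snd p = i))) = f (fst p) - f (snd p)"
        using fin by (simp add: right_diff_distrib sum_subtractf mult_of_bool)
    qed simp
    finally show ?thesis .
  qed
  have "(\<Sum>i\<in>I. d i) = 0" using pairing[of "\<lambda>_. 1"] by simp
  then have "(\<Sum>i\<in>I. lookup \<beta> i) = (\<Sum>i\<in>I. lookup \<kappa> i)"
    by (simp add: entry sum.distrib)
  then show "(\<Sum>i\<in>keys (raising_prod S \<kappa>). lookup (raising_prod S \<kappa>) i) = (\<Sum>i\<in>keys \<kappa>. lookup \<kappa> i)"
    unfolding \<beta>_def[symmetric] to_I[OF subI(1), where f = "\<lambda>x. x", OF refl]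
      to_I[OF subI(2), where f = "\<lambda>x. x", OF refl] .
  assume "S \<noteq> {}"
  have "(\<Sum>i\<in>I. lookup \<kappa> i * d i) \<ge> 0"
    unfolding pairing
  proof (rule sum_nonneg)
    fix p assume "p \<in> S"
    then have "fst p \<le> snd p" using assms(2) by auto
    then show "0 \<le> lookup \<kappa> (fst p) - lookup \<kappa> (snd p)"
      using partition_antimono[OF assms(3)] by simp
  qed
  moreover have "(\<Sum>i\<in>I. (d i)\<^sup>2) > 0"
  proof -
    \<comment> \<open>No pair ends at the smallest position occurring in \<open>S\<close>, so this entry is strictly raised and
      $d \neq 0$.\<close>
    define a where "a = Min (fst ` S)"
    have a: "a \<in> fst ` S" using assms(1) \<open>S \<noteq> {}\<close> by (simp add: a_def)
    have ge_a: "a \<le> fst p" if "p \<in> S" for p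
      using that assms(1) by (simp add: a_def)
    have "(\<Sum>p\<in>S. 0) < d a"
      unfolding d_def
    proof (rule sum_strict_mono_ex1)
      have "snd p \<noteq> a" if "p \<in> S" for p
        using ge_a[OF that] that assms(2) by auto
      then show "\<forall>p\<in>S. (0 :: int) \<le> of_bool (fst p = a) - of_bool (snd p = a)"
        "\<exists>p\<in>S. (0 :: int) < of_bool (fst p = a) - of_bool (snd p = a)"
        using a by auto
    qed fact
    then show ?thesis
      using fin a by (intro sum_pos2[of I a]) (auto simp: I_def)
  qed
  moreover have "(\<Sum>i\<in>I. (lookup \<beta> i)\<^sup>2) =
      (\<Sum>i\<in>I. (lookup \<kappa> i)\<^sup>2) + (\<Sum>i\<in>I. (d i)\<^sup>2) + 2 * (\<Sum>i\<in>I. lookup \<kappa> i * d i)"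
    unfolding entry power2_sum sum.distrib sum_distrib_left mult.assoc ..
  ultimately have "(\<Sum>i\<in>I. (lookup \<beta> i)\<^sup>2) > (\<Sum>i\<in>I. (lookup \<kappa> i)\<^sup>2)"
    by linarith
  then show "(\<Sum>i\<in>keys (raising_prod S \<kappa>). (lookup (raising_prod S \<kappa>) i)\<^sup>2) > (\<Sum>i\<in>keys \<kappa>. (lookup \<kappa> i)\<^sup>2)"
    unfolding \<beta>_def[symmetric] to_I[OF subI(1), where f = "\<lambda>x. x\<^sup>2", OF zero_power2]
      to_I[OF subI(2), where f = "\<lambda>x. x\<^sup>2", OF zero_power2] .
qed

text \<open>
  Unitriangularity of the Schur polynomials; the leading term is the choice $S = \emptyset$.
\<close>

lemma keys_schur_minus_leading:
  assumes "is_partition \<kappa>"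
  shows "keys (schur \<kappa> - frag_of (mon \<kappa>)) \<subseteq>
    {m. wdeg m = wdeg (mon \<kappa>) \<and> sqdeg m > sqdeg (mon \<kappa>)}"
proof -
  let ?T = "{S. finite S \<and> S \<subseteq> {(i, j). i < j} \<and> u_vec (raising_prod S \<kappa>) \<noteq> 0}"
  let ?f = "\<lambda>S. (- 1) ^ card S * u_vec (raising_prod S \<kappa>)"
  have "{} \<in> ?T" using assms by (simp add: raising_prod_def u_vec_partition)
  then have "sum ?f ?T = ?f {} + sum ?f (?T - {{}})"
    by (rule sum.remove[OF finite_schur_index])
  then have "schur \<kappa> - frag_of (mon \<kappa>) = sum ?f (?T - {{}})"
    using assms by (simp add: schur_def raising_prod_def u_vec_partition)
  moreover have "keys (?f S) \<subseteq> {m. wdeg m = wdeg (mon \<kappa>) \<and> sqdeg m > sqdeg (mon \<kappa>)}"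
    if "S \<in> ?T - {{}}" for S
  proof -
    have S: "finite S" "S \<subseteq> {(i, j). i < j}" "S \<noteq> {}" "u_vec (raising_prod S \<kappa>) \<noteq> 0"
      using that by auto
    have nonneg: "lookup (raising_prod S \<kappa>) i \<ge> 0" for i
      using S(4) u_vec_neg by (meson not_le)
    have "?f S = u_vec (raising_prod S \<kappa>) \<or> ?f S = - u_vec (raising_prod S \<kappa>)"
      by (cases "even (card S)") simp_all
    then have "keys (?f S) = {mon (raising_prod S \<kappa>)}"
      using u_vec_nonneg[of "raising_prod S \<kappa>"] nonneg by auto
    moreover have "wdeg (mon (raising_prod S \<kappa>)) = wdeg (mon \<kappa>)"
      using raising_prod_statistics(1)[OF S(1,2) assms] partition_nonneg[OF assms] nonneg
      by (simp flip: int_wdeg_mon)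
    moreover have "sqdeg (mon (raising_prod S \<kappa>)) > sqdeg (mon \<kappa>)"
      using raising_prod_statistics(2)[OF S(1,2) assms S(3)] partition_nonneg[OF assms] nonneg
      by (simp flip: int_sqdeg_mon)
    ultimately show ?thesis by auto
  qed
  ultimately show ?thesis
    using keys_sum[of ?f "?T - {{}}"] by (metis (no_types, lifting) UN_least order_trans)
qed

section \<open>The basis of Schur polynomials\<close>

text \<open>
  Polynomials are formal integer combinations of monomials, so the linear algebra below uses the
  operations of free abelian groups.
\<close>

lemma of_int_mult_poly: "of_int k * p = frag_cmul k (p :: upoly)"
proof -
  have "of_int k * p = Poly_Mapping.map ((*) k) p"
    by (metis mult_map_scale_conv_mult single_of_int of_int_eq_id id_apply)
  then show ?thesis
    by (auto intro!: poly_mapping_eqI simp: map.rep_eq when_def)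
qed

lemma lookup_schur_leading:
  assumes "is_partition \<kappa>"
  shows "lookup (schur \<kappa>) (mon \<kappa>) = 1"
proof -
  have "mon \<kappa> \<notin> keys (schur \<kappa> - frag_of (mon \<kappa>))"
    using keys_schur_minus_leading[OF assms] by blast
  then show ?thesis by (simp add: in_keys_iff lookup_minus)
qed

lemma keys_schur:
  assumes "is_partition \<kappa>" "m \<in> keys (schur \<kappa>)"
  shows "wdeg m = wdeg (mon \<kappa>)" "m \<noteq> mon \<kappa> \<Longrightarrow> sqdeg m > sqdeg (mon \<kappa>)"
proof -
  have "m = mon \<kappa> \<or> m \<in> keys (schur \<kappa> - frag_of (mon \<kappa>))"
    using assms(2) by (auto simp: in_keys_iff lookup_minus)
  then show "wdeg m = wdeg (mon \<kappa>)" "m \<noteq> mon \<kappa> \<Longrightarrow> sqdeg m > sqdeg (mon \<kappa>)"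
    using keys_schur_minus_leading[OF assms(1)] by blast+
qed

lemma finite_wdeg: "finite {m. wdeg m = n}"
proof -
  have le: "Suc k * lookup m k \<le> wdeg m" for k and m :: "nat \<Rightarrow>\<^sub>0 nat"
  proof (cases "k \<in> keys m")
    case True
    then show ?thesis unfolding wdeg_def by (intro member_le_sum) auto
  qed (simp add: in_keys_iff)
  have "lookup ` {m. wdeg m = n} \<subseteq> {f. \<forall>k. (k \<in> {..<n} \<longrightarrow> f k \<in> {..n}) \<and> (k \<notin> {..<n} \<longrightarrow> f k = 0)}"
  proof clarify
    fix m :: "nat \<Rightarrow>\<^sub>0 nat" and k
    have "k \<notin> {..<wdeg m} \<Longrightarrow> lookup m k = 0"
      using le[of k m] by (cases "lookup m k") auto
    moreover have "lookup m k \<le> wdeg m" using le[of k m] by simp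
    ultimately show "(k \<in> {..<wdeg m} \<longrightarrow> lookup m k \<in> {..wdeg m}) \<and> (k \<notin> {..<wdeg m} \<longrightarrow> lookup m k = 0)"
      by simp
  qed
  then have "finite (lookup ` {m. wdeg m = n})"
    by (rule finite_subset) (rule finite_set_of_finite_funs; simp)
  then show ?thesis
    by (rule finite_imageD) (simp add: inj_on_def poly_mapping_eqI)
qed

lemma finite_partitions_of: "finite (partitions_of n)"
proof (rule finite_imageD)
  show "finite (mon ` partitions_of n)"
    by (rule finite_subset[OF _ finite_wdeg[of n]]) (auto simp: partitions_of_eq)
  show "inj_on mon (partitions_of n)"
    by (auto simp: inj_on_def partitions_of_eq mon_inj)
qed

lemma lookup_frag_extend:
  assumes "finite I" "keys c \<subseteq> I"
  shows "lookup (frag_extend f c) x = (\<Sum>i\<in>I. lookup c i * lookup (f i) x)"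
  unfolding frag_extend_def lookup_sum lookup_frag_cmul
  by (rule sum.mono_neutral_left) (use assms in \<open>auto simp: in_keys_iff\<close>)

text \<open>
  Among the partitions occurring in a relation choose one with the least sum of squares; its leading
  monomial occurs in no other term.
\<close>

lemma schur_independent:
  assumes "keys c \<subseteq> partitions" "frag_extend schur c = 0"
  shows "c = 0"
proof (rule ccontr)
  assume "c \<noteq> 0"
  then obtain \<nu>0 where "\<nu>0 \<in> keys c" by (metis keys_eq_empty ex_in_conv)
  then obtain \<nu> where \<nu>: "\<nu> \<in> keys c" and least: "\<And>\<kappa>. \<kappa> \<in> keys c \<Longrightarrow> sqdeg (mon \<nu>) \<le> sqdeg (mon \<kappa>)"
    using ex_has_least_nat[of "\<lambda>\<nu>. \<nu> \<in> keys c" \<nu>0 "\<lambda>\<nu>. sqdeg (mon \<nu>)"] by blast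
  have part: "is_partition \<kappa>" if "\<kappa> \<in> keys c" for \<kappa>
    using that assms(1) by (auto simp: partitions_def)
  have "lookup c \<kappa> * lookup (schur \<kappa>) (mon \<nu>) = 0" if "\<kappa> \<in> keys c - {\<nu>}" for \<kappa>
  proof -
    have "mon \<nu> \<noteq> mon \<kappa>" using that \<nu> part mon_inj by blast
    then have "mon \<nu> \<notin> keys (schur \<kappa>)"
      using that keys_schur(2)[of \<kappa> "mon \<nu>"] part least[of \<kappa>] by auto
    then show ?thesis by (simp add: in_keys_iff)
  qed
  then have "lookup (frag_extend schur c) (mon \<nu>) = lookup c \<nu> * lookup (schur \<nu>) (mon \<nu>)"
    unfolding lookup_frag_extend[OF finite_keys order_refl]
    using \<nu> by (simp add: sum.remove[OF finite_keys] sum.neutral del: sum.neutral_const)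
  then have "lookup c \<nu> = 0"
    using assms(2) lookup_schur_leading[OF part[OF \<nu>]] by simp
  with \<nu> show False by (simp add: in_keys_iff)
qed

text \<open>
  The monomials of $U_\nu$ other than the leading one have the same degree and a larger sum of squares,
  and there are only finitely many monomials of a given degree, so eliminating the remaining terms
  comes to an end.
\<close>

lemma schur_span:
  "\<exists>c. keys c \<subseteq> partitions_of (wdeg m) \<and> frag_extend schur c = frag_of m"
proof (induction "card {m'. wdeg m' = wdeg m \<and> sqdeg m' > sqdeg m}" arbitrary: m rule: less_induct)
  case less
  obtain \<nu> where \<nu>: "is_partition \<nu>" "mon \<nu> = m" using mon_surj by blast
  have "\<exists>c. keys c \<subseteq> partitions_of (wdeg m) \<and> frag_extend schur c = schur \<nu> - frag_of m"
    using keys_schur_minus_leading[OF \<nu>(1)] unfolding \<nu>(2)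
  proof (induction rule: frag_induction)
    case zero
    then show ?case by (intro exI[of _ 0]) simp
  next
    case (one m')
    then have "{m''. wdeg m'' = wdeg m' \<and> sqdeg m'' > sqdeg m'} \<subset> {m''. wdeg m'' = wdeg m \<and> sqdeg m'' > sqdeg m}"
      by fastforce
    then have "card {m''. wdeg m'' = wdeg m' \<and> sqdeg m'' > sqdeg m'} < card {m''. wdeg m'' = wdeg m \<and> sqdeg m'' > sqdeg m}"
      by (rule psubset_card_mono[rotated]) (rule finite_subset[OF _ finite_wdeg[of "wdeg m"]], blast)
    from less[OF this] one show ?case by simp
  next
    case (diff p q)
    then obtain c d where "keys c \<subseteq> partitions_of (wdeg m)" "frag_extend schur c = p"
      "keys d \<subseteq> partitions_of (wdeg m)" "frag_extend schur d = q" by blast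
    then show ?case
      using keys_diff[of c d] by (intro exI[of _ "c - d"]) (auto simp: frag_extend_diff)
  qed
  then obtain c where "keys c \<subseteq> partitions_of (wdeg m)" "frag_extend schur c = schur \<nu> - frag_of m" by blast
  then show ?case
    using keys_diff[of "frag_of \<nu>" c] \<nu>
    by (intro exI[of _ "frag_of \<nu> - c"]) (auto simp: frag_extend_diff partitions_of_eq)
qed

lemma partitions_of_subset: "partitions_of n \<subseteq> partitions"
  by (auto simp: partitions_of_def partitions_def)

text \<open>
  The Kostka numbers are the coefficients of any such expansion, since independence makes the expansion
  unique.  As the expansion obtained here stays in one degree, the Kostka matrix is block diagonal.
\<close>

lemma kostka_expansion:
  assumes "\<mu> \<in> partitions_of n"
  obtains c where "keys c \<subseteq> partitions_of n" "u_vec \<mu> = frag_extend schur c" "\<And>\<kappa>. kostka \<kappa> \<mu> = lookup c \<kappa>"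
proof -
  have u: "u_vec \<mu> = frag_of (mon \<mu>)" and n: "wdeg (mon \<mu>) = n"
    using assms by (auto simp: partitions_of_eq u_vec_partition)
  obtain c where c: "keys c \<subseteq> partitions_of n" "u_vec \<mu> = frag_extend schur c"
    using schur_span[of "mon \<mu>"] unfolding n u by metis
  have "(THE c. keys c \<subseteq> partitions \<and> u_vec \<mu> = frag_extend schur c) = c"
  proof (rule the_equality)
    show "keys c \<subseteq> partitions \<and> u_vec \<mu> = frag_extend schur c"
      using c partitions_of_subset by blast
    fix d assume d: "keys d \<subseteq> partitions \<and> u_vec \<mu> = frag_extend schur d"
    have "d - c = 0"
      using c d keys_diff[of d c] partitions_of_subset
      by (intro schur_independent) (fastforce simp: frag_extend_diff)+
    then show "d = c" by simp
  qed
  then have "kostka \<kappa> \<mu> = lookup c \<kappa>" for \<kappa>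
    by (simp add: kostka_def of_int_mult_poly frag_extend_def)
  with c that show ?thesis by blast
qed

lemma kostka_degree:
  assumes "is_partition \<kappa>" "is_partition \<mu>" "kostka \<kappa> \<mu> \<noteq> 0"
  shows "wdeg (mon \<kappa>) = wdeg (mon \<mu>)"
proof -
  have "\<mu> \<in> partitions_of (wdeg (mon \<mu>))" using assms by (simp add: partitions_of_eq)
  from kostka_expansion[OF this] obtain c where
    c: "keys c \<subseteq> partitions_of (wdeg (mon \<mu>))" "kostka \<kappa> \<mu> = lookup c \<kappa>" by metis
  then have "\<kappa> \<in> partitions_of (wdeg (mon \<mu>))"
    using assms(3) by (auto simp: in_keys_iff)
  then show ?thesis by (simp add: partitions_of_eq)
qed

text \<open>
  Expanding $u_\mu$ in the Schur polynomials and these again in the $u_\nu$ gives $u_\mu$ back.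
\<close>

lemma kostka_schur_coeff:
  assumes "\<mu> \<in> partitions_of n" "\<nu> \<in> partitions_of n"
  shows "(\<Sum>\<kappa>\<in>partitions_of n. kostka \<kappa> \<mu> * lookup (schur \<kappa>) (mon \<nu>)) = of_bool (\<mu> = \<nu>)"
proof -
  obtain c where c: "keys c \<subseteq> partitions_of n" "u_vec \<mu> = frag_extend schur c" "\<And>\<kappa>. kostka \<kappa> \<mu> = lookup c \<kappa>"
    using kostka_expansion[OF assms(1)] by blast
  have "(\<Sum>\<kappa>\<in>partitions_of n. kostka \<kappa> \<mu> * lookup (schur \<kappa>) (mon \<nu>)) = lookup (u_vec \<mu>) (mon \<nu>)"
    unfolding c(2,3) by (rule lookup_frag_extend[OF finite_partitions_of c(1), symmetric])
  also have "\<dots> = of_bool (\<mu> = \<nu>)"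
    using assms mon_inj[of \<mu> \<nu>] by (auto simp: partitions_of_eq u_vec_partition)
  finally show ?thesis .
qed

lemma schur_u_expansion:
  assumes "\<kappa> \<in> partitions_of n"
  shows "schur \<kappa> = (\<Sum>\<nu>\<in>partitions_of n. frag_cmul (lookup (schur \<kappa>) (mon \<nu>)) (u_vec \<nu>))"
proof -
  have inj: "inj_on mon (partitions_of n)"
    by (auto simp: inj_on_def partitions_of_eq mon_inj)
  have "keys (schur \<kappa>) \<subseteq> mon ` partitions_of n"
  proof
    fix m assume "m \<in> keys (schur \<kappa>)"
    then have "wdeg m = n" using keys_schur(1)[of \<kappa> m] assms by (auto simp: partitions_of_eq)
    then show "m \<in> mon ` partitions_of n" using mon_surj[of m] by (auto simp: partitions_of_eq)
  qed
  then have "(\<Sum>m\<in>keys (schur \<kappa>). frag_cmul (lookup (schur \<kappa>) m) (frag_of m)) =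
      (\<Sum>m\<in>mon ` partitions_of n. frag_cmul (lookup (schur \<kappa>) m) (frag_of m))"
    by (intro sum.mono_neutral_left) (auto simp: in_keys_iff finite_partitions_of)
  also have "\<dots> = (\<Sum>\<nu>\<in>partitions_of n. frag_cmul (lookup (schur \<kappa>) (mon \<nu>)) (u_vec \<nu>))"
    unfolding sum.reindex[OF inj] by (rule sum.cong) (auto simp: partitions_of_eq u_vec_partition)
  finally show ?thesis
    using frag_expansion[of "schur \<kappa>"] by (simp add: frag_extend_def)
qed

text \<open>
  The opposite composition: expanding $U_\kappa$ in the $u_\mu$ and these in the Schur polynomials.
\<close>

lemma schur_coeff_kostka:
  assumes "\<kappa> \<in> partitions_of n" "\<rho> \<in> partitions_of n"
  shows "(\<Sum>\<mu>\<in>partitions_of n. kostka \<rho> \<mu> * lookup (schur \<kappa>) (mon \<mu>)) = of_bool (\<kappa> = \<rho>)"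
proof -
  have "\<forall>\<mu>\<in>partitions_of n. \<exists>c. keys c \<subseteq> partitions_of n \<and> u_vec \<mu> = frag_extend schur c \<and> (\<forall>\<kappa>. kostka \<kappa> \<mu> = lookup c \<kappa>)"
    using kostka_expansion by metis
  then obtain c where c: "\<And>\<mu>. \<mu> \<in> partitions_of n \<Longrightarrow> keys (c \<mu>) \<subseteq> partitions_of n"
    "\<And>\<mu>. \<mu> \<in> partitions_of n \<Longrightarrow> u_vec \<mu> = frag_extend schur (c \<mu>)"
    "\<And>\<mu> \<kappa>. \<mu> \<in> partitions_of n \<Longrightarrow> kostka \<kappa> \<mu> = lookup (c \<mu>) \<kappa>"
    by metis
  define d where "d = (\<Sum>\<mu>\<in>partitions_of n. frag_cmul (lookup (schur \<kappa>) (mon \<mu>)) (c \<mu>))"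
  have "frag_extend schur d = (\<Sum>\<mu>\<in>partitions_of n. frag_cmul (lookup (schur \<kappa>) (mon \<mu>)) (u_vec \<mu>))"
    unfolding d_def frag_extend_sum[OF finite_partitions_of] o_def frag_extend_cmul
    by (rule sum.cong) (simp_all add: c(2))
  also have "\<dots> = schur \<kappa>" by (rule schur_u_expansion[OF assms(1), symmetric])
  finally have d: "frag_extend schur d = schur \<kappa>" .
  have "d - frag_of \<kappa> = 0"
  proof (rule schur_independent)
    show "frag_extend schur (d - frag_of \<kappa>) = 0"
      using d by (simp add: frag_extend_diff)
    have "keys d \<subseteq> partitions_of n"
      unfolding d_def by (rule order_trans[OF keys_sum]) (use c(1) in auto)
    then show "keys (d - frag_of \<kappa>) \<subseteq> partitions"
      using keys_diff[of d "frag_of \<kappa>"] partitions_of_subset[of n] assms(1) by fastforce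
  qed
  then have "d = frag_of \<kappa>" by simp
  then have "lookup d \<rho> = of_bool (\<kappa> = \<rho>)" by auto
  moreover have "lookup d \<rho> = (\<Sum>\<mu>\<in>partitions_of n. kostka \<rho> \<mu> * lookup (schur \<kappa>) (mon \<mu>))"
    unfolding d_def lookup_sum by (rule sum.cong) (simp_all add: c(3))
  ultimately show ?thesis by simp
qed

section \<open>The dual family\<close>

lemma frag_cmul_sum_left: "frag_cmul (\<Sum>i\<in>I. f i) x = (\<Sum>i\<in>I. frag_cmul (f i) x)"
  by (induction I rule: infinite_finite_induct) (simp_all add: frag_cmul_distrib)

lemma kostka_sum:
  fixes t :: "intvec \<Rightarrow> upoly"
  assumes "\<kappa> \<in> partitions_of n"
  shows "(\<Sum>\<mu> | is_partition \<mu> \<and> kostka \<kappa> \<mu> \<noteq> 0. of_int (kostka \<kappa> \<mu>) * t \<mu>) =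
    (\<Sum>\<mu>\<in>partitions_of n. frag_cmul (kostka \<kappa> \<mu>) (t \<mu>))"
  unfolding of_int_mult_poly
  by (rule sum.mono_neutral_left)
     (use assms kostka_degree in \<open>auto simp: partitions_of_eq finite_partitions_of[unfolded partitions_of_eq]\<close>)

text \<open>
  One product of the two coefficient matrices shows that the right-hand side solves the defining system
  (\<open>schur_coeff_kostka\<close>), the other one that every solution has this form (\<open>kostka_schur_coeff\<close>).
\<close>

lemma t_poly_eq:
  assumes "\<nu> \<in> partitions_of n"
  shows "t_poly \<nu> = (\<Sum>\<kappa>\<in>partitions_of n. frag_cmul (lookup (schur \<kappa>) (mon \<nu>)) (schur \<kappa>))"
proof -
  define s where "s \<nu> = (if is_partition \<nu> then
      \<Sum>\<kappa>\<in>partitions_of (wdeg (mon \<nu>)). frag_cmul (lookup (schur \<kappa>) (mon \<nu>)) (schur \<kappa>) else 0)" for \<nu>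
  have s_eq: "s \<nu> = (\<Sum>\<kappa>\<in>partitions_of n. frag_cmul (lookup (schur \<kappa>) (mon \<nu>)) (schur \<kappa>))"
    if "\<nu> \<in> partitions_of n" for \<nu> n
    using that by (simp add: s_def partitions_of_eq)
  have own: "\<kappa> \<in> partitions_of (wdeg (mon \<kappa>))" if "is_partition \<kappa>" for \<kappa>
    using that by (simp add: partitions_of_eq)
  have "t_poly = s"
    unfolding t_poly_def
  proof (rule the_equality, intro conjI allI impI)
    show "s \<mu> = 0" if "\<not> is_partition \<mu>" for \<mu>
      using that by (simp add: s_def)
    fix \<rho> assume "is_partition \<rho>"
    define N where "N = partitions_of (wdeg (mon \<rho>))"
    have \<rho>: "\<rho> \<in> N" and fin: "finite N"
      using own[OF \<open>is_partition \<rho>\<close>] by (simp_all add: N_def finite_partitions_of)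
    have "(\<Sum>\<mu>\<in>N. frag_cmul (kostka \<rho> \<mu>) (s \<mu>)) =
        (\<Sum>\<mu>\<in>N. \<Sum>\<kappa>\<in>N. frag_cmul (kostka \<rho> \<mu> * lookup (schur \<kappa>) (mon \<mu>)) (schur \<kappa>))"
      by (rule sum.cong) (simp_all add: N_def s_eq frag_cmul_sum)
    also have "\<dots> = (\<Sum>\<kappa>\<in>N. frag_cmul (\<Sum>\<mu>\<in>N. kostka \<rho> \<mu> * lookup (schur \<kappa>) (mon \<mu>)) (schur \<kappa>))"
      unfolding frag_cmul_sum_left by (rule sum.swap)
    also have "\<dots> = (\<Sum>\<kappa>\<in>N. if \<kappa> = \<rho> then schur \<kappa> else 0)"
      by (rule sum.cong) (use \<rho> in \<open>simp_all add: N_def schur_coeff_kostka\<close>)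
    also have "\<dots> = schur \<rho>" using \<rho> fin by simp
    finally show "schur \<rho> = (\<Sum>\<mu> | is_partition \<mu> \<and> kostka \<rho> \<mu> \<noteq> 0. of_int (kostka \<rho> \<mu>) * s \<mu>)"
      using \<rho> by (simp add: N_def kostka_sum)
  next
    fix t :: "intvec \<Rightarrow> upoly"
    assume t: "(\<forall>\<mu>. \<not> is_partition \<mu> \<longrightarrow> t \<mu> = 0) \<and> (\<forall>\<kappa>. is_partition \<kappa> \<longrightarrow>
        schur \<kappa> = (\<Sum>\<mu> | is_partition \<mu> \<and> kostka \<kappa> \<mu> \<noteq> 0. of_int (kostka \<kappa> \<mu>) * t \<mu>))"
    show "t = s"
    proof
      fix \<nu>
      show "t \<nu> = s \<nu>"
      proof (cases "is_partition \<nu>")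
        case True
        define N where "N = partitions_of (wdeg (mon \<nu>))"
        have \<nu>: "\<nu> \<in> N" and fin: "finite N"
          using own[OF True] by (simp_all add: N_def finite_partitions_of)
        have schur_t: "schur \<kappa> = (\<Sum>\<mu>\<in>N. frag_cmul (kostka \<kappa> \<mu>) (t \<mu>))" if "\<kappa> \<in> N" for \<kappa>
          using t kostka_sum[OF that[unfolded N_def], of t] that by (simp add: N_def partitions_of_eq)
        have "s \<nu> = (\<Sum>\<kappa>\<in>N. frag_cmul (lookup (schur \<kappa>) (mon \<nu>)) (schur \<kappa>))"
          using \<nu> by (simp add: N_def s_eq)
        also have "\<dots> = (\<Sum>\<kappa>\<in>N. \<Sum>\<mu>\<in>N. frag_cmul (kostka \<kappa> \<mu> * lookup (schur \<kappa>) (mon \<nu>)) (t \<mu>))"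
        proof (rule sum.cong)
          fix \<kappa> assume "\<kappa> \<in> N"
          show "frag_cmul (lookup (schur \<kappa>) (mon \<nu>)) (schur \<kappa>) =
              (\<Sum>\<mu>\<in>N. frag_cmul (kostka \<kappa> \<mu> * lookup (schur \<kappa>) (mon \<nu>)) (t \<mu>))"
            by (subst (2) schur_t[OF \<open>\<kappa> \<in> N\<close>]) (simp add: frag_cmul_sum mult.commute)
        qed simp
        also have "\<dots> = (\<Sum>\<mu>\<in>N. frag_cmul (\<Sum>\<kappa>\<in>N. kostka \<kappa> \<mu> * lookup (schur \<kappa>) (mon \<nu>)) (t \<mu>))"
          unfolding frag_cmul_sum_left by (rule sum.swap)
        also have "\<dots> = (\<Sum>\<mu>\<in>N. if \<mu> = \<nu> then t \<mu> else 0)"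
          by (rule sum.cong) (use \<nu> in \<open>simp_all add: N_def kostka_schur_coeff\<close>)
        also have "\<dots> = t \<nu>" using \<nu> fin by simp
        finally show ?thesis by simp
      qed (use t in \<open>simp add: s_def\<close>)
    qed
  qed
  with s_eq[OF assms] show ?thesis by simp
qed

section \<open>The Cauchy identity\<close>

lemma tensor_prod_add_left: "(a + a') \<otimes>\<^sub>Z b = a \<otimes>\<^sub>Z b + a' \<otimes>\<^sub>Z b"
  by transfer (simp add: tensor_eq_def tensor_rel.left diff_diff_eq[symmetric])

lemma tensor_prod_add_right: "a \<otimes>\<^sub>Z (b + b') = a \<otimes>\<^sub>Z b + a \<otimes>\<^sub>Z b'"
  by transfer (simp add: tensor_eq_def tensor_rel.right diff_diff_eq[symmetric])

lemma tensor_prod_zero_left [simp]: "0 \<otimes>\<^sub>Z b = 0"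
  using tensor_prod_add_left[of 0 0 b] by simp

lemma tensor_prod_zero_right [simp]: "a \<otimes>\<^sub>Z 0 = 0"
  using tensor_prod_add_right[of a 0 0] by simp

lemma tensor_prod_sum_left: "(\<Sum>i\<in>I. f i) \<otimes>\<^sub>Z b = (\<Sum>i\<in>I. f i \<otimes>\<^sub>Z b)"
  by (induction I rule: infinite_finite_induct) (simp_all add: tensor_prod_add_left)

lemma tensor_prod_sum_right: "a \<otimes>\<^sub>Z (\<Sum>i\<in>I. f i) = (\<Sum>i\<in>I. a \<otimes>\<^sub>Z f i)"
  by (induction I rule: infinite_finite_induct) (simp_all add: tensor_prod_add_right)

lemma tensor_prod_frag_cmul: "frag_cmul k a \<otimes>\<^sub>Z b = a \<otimes>\<^sub>Z frag_cmul k b"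
proof (induction k rule: int_induct[of _ 0])
  case (step1 k)
  then show ?case
    by (simp add: frag_cmul_distrib tensor_prod_add_left tensor_prod_add_right)
next
  case (step2 k)
  have "frag_cmul (k - 1) a \<otimes>\<^sub>Z b + a \<otimes>\<^sub>Z b = frag_cmul k a \<otimes>\<^sub>Z b"
    using frag_cmul_distrib[of "k - 1" 1 a] by (simp flip: tensor_prod_add_left)
  moreover have "a \<otimes>\<^sub>Z frag_cmul (k - 1) b + a \<otimes>\<^sub>Z b = a \<otimes>\<^sub>Z frag_cmul k b"
    using frag_cmul_distrib[of "k - 1" 1 b] by (simp flip: tensor_prod_add_right)
  ultimately show ?case
    using step2 by (metis add_right_cancel)
qed simp

text \<open>
  Expanding only the second factor of $U_\kappa \otimes U_\kappa$ and moving the integer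
  coefficients to the first factor collects exactly $t_\nu$ in front of $u_\nu$.
\<close>

lemma cauchy_homogeneous:
  "(\<Sum>\<kappa>\<in>partitions_of n. schur \<kappa> \<otimes>\<^sub>Z schur \<kappa>) = (\<Sum>\<kappa>\<in>partitions_of n. t_poly \<kappa> \<otimes>\<^sub>Z u_vec \<kappa>)"
proof -
  let ?N = "partitions_of n"
  have "(\<Sum>\<kappa>\<in>?N. schur \<kappa> \<otimes>\<^sub>Z schur \<kappa>) =
      (\<Sum>\<kappa>\<in>?N. \<Sum>\<nu>\<in>?N. frag_cmul (lookup (schur \<kappa>) (mon \<nu>)) (schur \<kappa>) \<otimes>\<^sub>Z u_vec \<nu>)"
  proof (rule sum.cong)
    fix \<kappa> assume "\<kappa> \<in> ?N"
    show "schur \<kappa> \<otimes>\<^sub>Z schur \<kappa> =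
        (\<Sum>\<nu>\<in>?N. frag_cmul (lookup (schur \<kappa>) (mon \<nu>)) (schur \<kappa>) \<otimes>\<^sub>Z u_vec \<nu>)"
      by (subst (2) schur_u_expansion[OF \<open>\<kappa> \<in> ?N\<close>])
         (simp add: tensor_prod_sum_right tensor_prod_frag_cmul)
  qed simp
  also have "\<dots> = (\<Sum>\<nu>\<in>?N. (\<Sum>\<kappa>\<in>?N. frag_cmul (lookup (schur \<kappa>) (mon \<nu>)) (schur \<kappa>)) \<otimes>\<^sub>Z u_vec \<nu>)"
    unfolding tensor_prod_sum_left by (rule sum.swap)
  also have "\<dots> = (\<Sum>\<nu>\<in>?N. t_poly \<nu> \<otimes>\<^sub>Z u_vec \<nu>)"
    by (rule sum.cong) (simp_all add: t_poly_eq)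
  finally show ?thesis .
qed

lemma bihom_comp_tensor_prod: "bihom_comp m n (a \<otimes>\<^sub>Z b) = hom_comp m a \<otimes>\<^sub>Z hom_comp n b"
  by transfer (simp add: tensor_eq_def tensor_rel.zero)

lemma bihom_comp_add: "bihom_comp m n (x + y) = bihom_comp m n x + bihom_comp m n y"
  by transfer (simp add: frag_extend_add tensor_eq_def tensor_rel.zero)

lemma bihom_comp_zero [simp]: "bihom_comp m n 0 = 0"
  using bihom_comp_add[of m n 0 0] by simp

lemma bihom_comp_sum: "bihom_comp m n (\<Sum>i\<in>I. f i) = (\<Sum>i\<in>I. bihom_comp m n (f i))"
  by (induction I rule: infinite_finite_induct) (simp_all add: bihom_comp_add)

lemma hom_comp_sum: "hom_comp d (\<Sum>i\<in>I. f i) = (\<Sum>i\<in>I. hom_comp d (f i))"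
  by (induction I rule: infinite_finite_induct) (simp_all add: hom_comp_add, simp_all add: hom_comp_def)

lemma hom_comp_schur:
  assumes "is_partition \<kappa>" "wdeg (mon \<kappa>) \<noteq> d"
  shows "hom_comp d (schur \<kappa>) = 0"
  unfolding hom_comp_def
  by (rule frag_extend_eq_0) (use keys_schur(1)[OF assms(1)] assms(2) in simp)

lemma hom_comp_t_poly:
  assumes "is_partition \<nu>" "wdeg (mon \<nu>) \<noteq> d"
  shows "hom_comp d (t_poly \<nu>) = 0"
proof -
  have "t_poly \<nu> = (\<Sum>\<kappa>\<in>partitions_of (wdeg (mon \<nu>)). frag_cmul (lookup (schur \<kappa>) (mon \<nu>)) (schur \<kappa>))"
    using assms(1) by (intro t_poly_eq) (simp add: partitions_of_eq)
  moreover have "hom_comp d (frag_cmul k (schur \<kappa>)) = 0"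
    if "\<kappa> \<in> partitions_of (wdeg (mon \<nu>))" for k \<kappa>
    using hom_comp_schur[of \<kappa> d] that assms(2)
    by (simp add: hom_comp_def frag_extend_cmul partitions_of_eq)
  ultimately show ?thesis
    by (simp add: hom_comp_sum)
qed

text \<open>
  The hypothesis holds as soon as the first tensor factor of $x_\kappa$ is homogeneous of degree
  $|\kappa|$, and lets an identity in every fixed degree pass to the formal sums.
\<close>

lemma formal_sum_partitions:
  assumes "\<And>\<kappa> m n. is_partition \<kappa> \<Longrightarrow> wdeg (mon \<kappa>) \<noteq> m \<Longrightarrow> bihom_comp m n (x \<kappa>) = 0"
  shows "formally_summable partitions x"
    and "formal_sum partitions x m n = bihom_comp m n (\<Sum>\<kappa>\<in>partitions_of m. x \<kappa>)"
proof -
  have sub: "{\<kappa> \<in> partitions. bihom_comp m n (x \<kappa>) \<noteq> 0} \<subseteq> partitions_of m" for m n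
    using assms by (auto simp: partitions_def partitions_of_eq)
  then show "formally_summable partitions x"
    unfolding formally_summable_def using finite_subset[OF _ finite_partitions_of] by blast
  show "formal_sum partitions x m n = bihom_comp m n (\<Sum>\<kappa>\<in>partitions_of m. x \<kappa>)"
    unfolding formal_sum_def bihom_comp_sum
    by (rule sum.mono_neutral_left[OF finite_partitions_of sub])
       (use partitions_of_subset in auto)
qed

theorem mainTheorem4:
  shows "(\<forall>n. (\<Sum>\<kappa>\<in>partitions_of n. schur \<kappa> \<otimes>\<^sub>Z schur \<kappa>) =
              (\<Sum>\<kappa>\<in>partitions_of n. t_poly \<kappa> \<otimes>\<^sub>Z u_vec \<kappa>)) \<and>
         formally_summable partitions (\<lambda>\<kappa>. schur \<kappa> \<otimes>\<^sub>Z schur \<kappa>) \<and>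
         formally_summable partitions (\<lambda>\<kappa>. t_poly \<kappa> \<otimes>\<^sub>Z u_vec \<kappa>) \<and>
         formal_sum partitions (\<lambda>\<kappa>. schur \<kappa> \<otimes>\<^sub>Z schur \<kappa>) =
         formal_sum partitions (\<lambda>\<kappa>. t_poly \<kappa> \<otimes>\<^sub>Z u_vec \<kappa>)"
proof -
  have U: "bihom_comp m n (schur \<kappa> \<otimes>\<^sub>Z schur \<kappa>) = 0"
    and T: "bihom_comp m n (t_poly \<kappa> \<otimes>\<^sub>Z u_vec \<kappa>) = 0"
    if "is_partition \<kappa>" "wdeg (mon \<kappa>) \<noteq> m" for \<kappa> m n
    using that by (simp_all add: bihom_comp_tensor_prod hom_comp_schur hom_comp_t_poly)
  show ?thesis
    using formal_sum_partitions[of "\<lambda>\<kappa>. schur \<kappa> \<otimes>\<^sub>Z schur \<kappa>", OF U]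
      formal_sum_partitions[of "\<lambda>\<kappa>. t_poly \<kappa> \<otimes>\<^sub>Z u_vec \<kappa>", OF T]
    by (simp add: cauchy_homogeneous fun_eq_iff)
qed

end
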